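(* Let $d,m\ge1$ be integers, let $A$ be a $(d+1)\times m$ real matrix with $\sigma(A)=\sigma<\infty$, let $\bm{\theta}\in\mathbb{R}^{d+m}$, and let $\varepsilon>0$. Then there is some positive constant $C^*(A,\varepsilon)$ depending only on $A$ and $\varepsilon$ such that for all $Q\in\mathbb{N}$ and $\delta>0$ we have $$N_A(Q,\delta,\bm{\theta})\le\max\left\{\pi^{2m},\ C^*(A,\varepsilon)\,\delta^mQ^{m\sigma+\varepsilon}\right\}.$$
   Context: Vectors are row vectors; $|\cdot|$ is the supremum norm; $\|\bm{y}\|$ is the sup-norm distance of $\bm{y}$ to the nearest integer vector (also for column vectors). The diophantine exponent $\omega(B)$ of a real matrix $B$ with $k$ columns is the supremum of all $\omega\in\mathbb{R}$ such that $\|B\bm{q}^{\mathrm T}\|<|\bm{q}|^{-\omega}$ holds for infinitely many $\bm{q}\in\mathbb{Z}^k$; $\sigma(A):=\omega(A^{\mathrm T})$. Write $\bm{\theta}=(\bm{\theta}^{(1)},\bm{\theta}^{(2)})\in\mathbb{R}^d\times\mathbb{R}^m$. The counting function is $$N_A(Q,\delta,\bm{\theta})=\#\{(q,\bm{a})\in\mathbb{Z}\times\mathbb{Z}^{d}: \|(q,\bm{a}+\bm{\theta}^{(1)})A-\bm{\theta}^{(2)}\|<\delta,\ |(q,\bm{a})|<Q\}.$$ *)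

theory Defs
  imports "HOL-Analysis.Analysis"
begin

definition of_int_vec :: "int ^ 'n \<Rightarrow> real ^ 'n" where
  "of_int_vec z = (\<chi> i. of_int (z $ i))"

(* The sup-norm on real ^ 'n is the library's infnorm. *)
definition dist_int_vec :: "real ^ 'n \<Rightarrow> real" where
  "dist_int_vec y = (INF z :: int ^ 'n. infnorm (y - of_int_vec z))"

(* The index type 'd option has CARD('d) + 1 elements; None is the index of the leading entry. *)
definition vec_cons :: "'a \<Rightarrow> 'a ^ 'd \<Rightarrow> 'a ^ ('d option)" where
  "vec_cons x v = (\<chi> i. case i of None \<Rightarrow> x | Some j \<Rightarrow> v $ j)"

(* The vector q = 0, where powr takes the value 0, is a single point
   and does not influence whether the set below is infinite. *)
definition diophantine_exponent :: "real ^ 'k ^ 'n \<Rightarrow> ereal" where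
  "diophantine_exponent B =
     (SUP w \<in> {w :: real. infinite {q :: int ^ 'k.
        dist_int_vec (B *v of_int_vec q) < infnorm (of_int_vec q) powr (- w)}}. ereal w)"

definition dual_exponent :: "real ^ 'm ^ 'n \<Rightarrow> ereal" where
  "dual_exponent A = diophantine_exponent (transpose A)"

definition counting_set ::
    "real ^ 'm ^ ('d option) \<Rightarrow> nat \<Rightarrow> real \<Rightarrow> (real ^ 'd) \<times> (real ^ 'm) \<Rightarrow> (int \<times> (int ^ 'd)) set" where
  "counting_set A Q \<delta> \<theta> = {(q, a).
     dist_int_vec (vec_cons (of_int q) (of_int_vec a + fst \<theta>) v* A - snd \<theta>) < \<delta> \<and>
     infnorm (of_int_vec (vec_cons q a)) < real Q}"

definition counting_function ::
    "real ^ 'm ^ ('d option) \<Rightarrow> nat \<Rightarrow> real \<Rightarrow> (real ^ 'd) \<times> (real ^ 'm) \<Rightarrow> nat" where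
  "counting_function A Q \<delta> \<theta> = card (counting_set A Q \<delta> \<theta>)"

lemma finite_counting_set:
  fixes A :: "real ^ 'm ^ ('d::finite option)"
  shows "finite (counting_set A Q \<delta> \<theta>)"
proof -
  let ?I = "{- int Q..int Q}"
  let ?F = "PiE UNIV (\<lambda>_. ?I) :: ('d \<Rightarrow> int) set"
  have "counting_set A Q \<delta> \<theta> \<subseteq> ?I \<times> (vec_lambda ` ?F)"
  proof (rule subsetI, clarify)
    fix q :: int and a :: "int ^ 'd"
    assume "(q, a) \<in> counting_set A Q \<delta> \<theta>"
    then have lt: "infnorm (of_int_vec (vec_cons q a)) < real Q"
      by (simp add: counting_set_def)
    have *: "\<bar>of_int_vec (vec_cons q a) $ i\<bar> < real Q" for i
      by (rule le_less_trans[OF component_le_infnorm_cart lt])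
    have q: "\<bar>q\<bar> < int Q"
      using *[of None] by (simp add: of_int_vec_def vec_cons_def)
    have a: "\<bar>a $ i\<bar> < int Q" for i
      using *[of "Some i"] by (simp add: of_int_vec_def vec_cons_def)
    have "a $ i \<in> ?I" for i
      using a[of i] by auto
    then have "vec_nth a \<in> ?F" by auto
    then have "a \<in> vec_lambda ` ?F"
      by (metis image_eqI vec_nth_inverse)
    moreover have "q \<in> ?I" using q by auto
    ultimately show "q \<in> ?I \<and> a \<in> vec_lambda ` ?F" by blast
  qed
  moreover have "finite ?F" by (rule finite_PiE) auto
  ultimately show ?thesis
    by (meson finite_SigmaI finite_atLeastAtMost_int finite_imageI finite_subset)
qed

end

theory Submission
  imports Defs
begin

text \<open>
  The proof is a packing argument on the torus \<open>\<real>\<^sup>m / \<int>\<^sup>m\<close>, equipped with the sup-norm distance.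

  If two distinct integer vectors contribute to the counting function, then the difference of
  the corresponding torus points is \<open>v A\<close> for a nonzero integer vector \<open>v\<close>: the shift
  \<open>\<theta>\<close> cancels. Since \<open>v\<close> has norm less than \<open>2 Q\<close>, a finite dual exponent says that \<open>v A\<close>
  stays away from the lattice by at least \<open>r = c (2 Q)\<^sup>-\<^sup>w\<close>, where \<open>w = \<sigma> + \<epsilon> / m\<close>; this is
  \<open>diophantine_exponent_lower_bound\<close>. It holds for every nonzero \<open>v\<close>, with \<open>c\<close> depending only on
  \<open>A\<close> and \<open>w\<close>: the finitely many \<open>v\<close> for which the inequality with \<open>c = 1\<close> fails only
  decrease \<open>c\<close>, and none of them can have \<open>v A\<close> at distance zero from the lattice, because then
  the same would hold for all multiples of \<open>v\<close>, and the exponent would be infinite.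

  All these torus points have representatives in the cube of side \<open>2 \<delta>\<close> around the origin,
  and a cube of that size holds at most \<open>(2 \<delta> / r + 1)\<^sup>m\<close> points at pairwise distance at least \<open>r\<close>
  (\<open>card_separated_le\<close>). If \<open>\<delta> \<le> r\<close>, this is at most \<open>3\<^sup>m \<le> \<pi>\<^sup>2\<^sup>m\<close>; otherwise it is at most
  \<open>(3 \<delta> / r)\<^sup>m\<close>, which is a constant times \<open>\<delta>\<^sup>m Q\<^sup>m\<^sup>w\<close>, and \<open>m w = m \<sigma> + \<epsilon>\<close>.
\<close>

section \<open>Integer vectors and the sup-norm\<close>

lemma infnorm_le_iff_cart:
  fixes x :: "real ^ 'n"
  shows "infnorm x \<le> r \<longleftrightarrow> (\<forall>i. \<bar>x $ i\<bar> \<le> r)"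
proof -
  have "infnorm x = Max (range (\<lambda>i. \<bar>x $ i\<bar>))"
    unfolding infnorm_cart by (subst cSup_eq_Max) (auto simp: full_SetCompr_eq)
  then show ?thesis by simp
qed

lemma infnorm_less_iff_cart:
  fixes x :: "real ^ 'n"
  shows "infnorm x < r \<longleftrightarrow> (\<forall>i. \<bar>x $ i\<bar> < r)"
proof -
  have "infnorm x = Max (range (\<lambda>i. \<bar>x $ i\<bar>))"
    unfolding infnorm_cart by (subst cSup_eq_Max) (auto simp: full_SetCompr_eq)
  then show ?thesis by simp
qed

lemma of_int_vec_diff: "of_int_vec (x - y) = of_int_vec x - of_int_vec y"
  by (simp add: of_int_vec_def vec_eq_iff)

lemma of_int_vec_scale: "of_int_vec (k *s x) = of_int k *\<^sub>R of_int_vec x"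
  by (simp add: of_int_vec_def vec_eq_iff)

lemma infnorm_of_int_vec_ge_1:
  fixes q :: "int ^ 'k"
  assumes "q \<noteq> 0"
  shows "1 \<le> infnorm (of_int_vec q)"
proof -
  obtain i where "q $ i \<noteq> 0"
    using assms by (auto simp: vec_eq_iff)
  then have "1 \<le> \<bar>of_int_vec q $ i\<bar>"
    by (simp add: of_int_vec_def)
  also have "\<dots> \<le> infnorm (of_int_vec q)"
    by (rule component_le_infnorm_cart)
  finally show ?thesis .
qed

section \<open>Distance to the integer lattice\<close>

lemma dist_int_vec_bdd_below: "bdd_below (range (\<lambda>z. infnorm (y - of_int_vec z)))"
  by (rule bdd_belowI[of _ 0]) (auto simp: infnorm_pos_le)

lemma dist_int_vec_nonneg: "0 \<le> dist_int_vec y"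
  unfolding dist_int_vec_def by (rule cINF_greatest) (auto simp: infnorm_pos_le)

lemma dist_int_vec_le: "dist_int_vec y \<le> infnorm (y - of_int_vec z)"
  unfolding dist_int_vec_def by (rule cINF_lower[OF dist_int_vec_bdd_below]) simp

lemma dist_int_vec_less_iff:
  "dist_int_vec y < r \<longleftrightarrow> (\<exists>z. infnorm (y - of_int_vec z) < r)"
  unfolding dist_int_vec_def using cINF_less_iff[OF _ dist_int_vec_bdd_below] by auto

lemma dist_int_vec_less_1: "dist_int_vec y < 1"
proof -
  have "infnorm (y - of_int_vec (\<chi> i. \<lfloor>y $ i\<rfloor>)) < 1"
    unfolding infnorm_less_iff_cart of_int_vec_def
    by (auto simp: abs_less_iff) linarith+
  then show ?thesis
    using dist_int_vec_less_iff by blast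
qed

lemma dist_int_vec_scale_le:
  "dist_int_vec (of_nat n *\<^sub>R y) \<le> of_nat n * dist_int_vec y"
proof (cases "n = 0")
  case True
  have "dist_int_vec (0 :: real ^ 'n) \<le> infnorm (0 - of_int_vec (0 :: int ^ 'n))"
    by (rule dist_int_vec_le)
  also have "0 - of_int_vec (0 :: int ^ 'n) = (0 :: real ^ 'n)"
    by (simp add: of_int_vec_def vec_eq_iff)
  finally show ?thesis
    using True by (simp add: infnorm_0)
next
  case False
  have "dist_int_vec (of_nat n *\<^sub>R y) / of_nat n \<le> infnorm (y - of_int_vec z)" for z
  proof -
    have "of_nat n *\<^sub>R y - of_int_vec (int n *s z) = of_nat n *\<^sub>R (y - of_int_vec z)"
      by (simp add: of_int_vec_scale scaleR_right_diff_distrib)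
    then have "infnorm (of_nat n *\<^sub>R y - of_int_vec (int n *s z))
        = of_nat n * infnorm (y - of_int_vec z)"
      by (simp add: infnorm_mul)
    then show ?thesis
      using dist_int_vec_le[of "of_nat n *\<^sub>R y" "int n *s z"] False
      by (simp add: field_simps)
  qed
  then have "dist_int_vec (of_nat n *\<^sub>R y) / of_nat n \<le> dist_int_vec y"
    unfolding dist_int_vec_def[of y] by (intro cINF_greatest) auto
  then show ?thesis
    using False by (simp add: field_simps)
qed

section \<open>Lower bounds from the diophantine exponent\<close>

lemma infinite_multiples:
  fixes q :: "int ^ 'k"
  assumes "q \<noteq> 0"
  shows "infinite (range (\<lambda>n. int (Suc n) *s q))"
proof -
  obtain i where "q $ i \<noteq> 0"
    using assms by (auto simp: vec_eq_iff)
  then have "inj (\<lambda>n. int (Suc n) *s q)"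
    by (auto simp: inj_on_def vec_eq_iff dest!: spec[of _ i])
  then show ?thesis
    by (rule range_inj_infinite)
qed

text \<open>
  For negative \<open>w\<close> the threshold \<open>|q| powr (- w)\<close> is at least \<open>1\<close>, whereas no point is at
  distance \<open>1\<close> or more from the lattice, so every nonzero \<open>q\<close> qualifies. The sign matters
  because a lower bound \<open>|v| powr (- w)\<close> is uniform over bounded \<open>v\<close> only if \<open>w \<ge> 0\<close>.
\<close>

lemma diophantine_exponent_nonneg: "0 \<le> diophantine_exponent B"
proof (rule ccontr)
  assume "\<not> 0 \<le> diophantine_exponent B"
  then obtain w where w: "diophantine_exponent B < ereal w" "w < 0"
    using ereal_dense2[of "diophantine_exponent B" 0] by (auto simp: not_le)
  let ?S = "{q. dist_int_vec (B *v of_int_vec q) < infnorm (of_int_vec q) powr (- w)}"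
  have "range (\<lambda>n. int (Suc n) *s 1) \<subseteq> ?S"
  proof (intro image_subsetI CollectI)
    fix n
    have "int (Suc n) *s 1 \<noteq> 0"
      by (simp add: vec_eq_iff)
    then have "1 \<le> infnorm (of_int_vec (int (Suc n) *s 1)) powr (- w)"
      using w(2) by (intro ge_one_powr_ge_zero infnorm_of_int_vec_ge_1) auto
    then show "dist_int_vec (B *v of_int_vec (int (Suc n) *s 1))
        < infnorm (of_int_vec (int (Suc n) *s 1)) powr (- w)"
      using dist_int_vec_less_1 less_le_trans by blast
  qed
  moreover have "infinite (range (\<lambda>n. int (Suc n) *s 1))"
    by (rule infinite_multiples) (simp add: vec_eq_iff)
  ultimately have "infinite ?S"
    using finite_subset by blast
  then have "ereal w \<le> diophantine_exponent B"
    unfolding diophantine_exponent_def by (intro SUP_upper) simp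
  then show False
    using w(1) by simp
qed

text \<open>
  A single nonzero \<open>q\<close> whose image is at distance zero from the lattice produces infinitely many
  such vectors, its multiples, and these qualify for every exponent. A bound on the exponent thus
  makes all distances positive, and only finitely many of them can spoil the constant \<open>1\<close>.
\<close>

lemma diophantine_exponent_lower_bound:
  fixes B :: "real ^ 'k ^ 'n"
  assumes "diophantine_exponent B < ereal w"
  obtains c where "c > 0"
    and "\<And>q. q \<noteq> 0 \<Longrightarrow> c * infnorm (of_int_vec q) powr (- w) \<le> dist_int_vec (B *v of_int_vec q)"
proof -
  let ?D = "\<lambda>q. dist_int_vec (B *v of_int_vec q)"
  let ?N = "\<lambda>q :: int ^ 'k. infnorm (of_int_vec q)"
  have fin: "finite {q. ?D q < ?N q powr (- w)}"
  proof (rule ccontr)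
    assume "infinite {q. ?D q < ?N q powr (- w)}"
    then have "ereal w \<le> diophantine_exponent B"
      unfolding diophantine_exponent_def by (intro SUP_upper) simp
    then show False
      using assms by simp
  qed
  have N_pos: "?N q > 0" if "q \<noteq> 0" for q
    using infnorm_of_int_vec_ge_1[OF that] by simp
  have D_pos: "?D q > 0" if "q \<noteq> 0" for q
  proof (rule ccontr)
    assume "\<not> ?D q > 0"
    then have zero: "?D q = 0"
      using dist_int_vec_nonneg[of "B *v of_int_vec q"] by simp
    have "range (\<lambda>n. int (Suc n) *s q) \<subseteq> {q. ?D q < ?N q powr (- w)}"
    proof (intro image_subsetI CollectI)
      fix n
      have "B *v of_int_vec (int (Suc n) *s q) = of_nat (Suc n) *\<^sub>R (B *v of_int_vec q)"
        unfolding of_int_vec_scale by (simp add: matrix_vector_mult_scaleR del: of_nat_Suc)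
      then have "?D (int (Suc n) *s q) \<le> 0"
        using dist_int_vec_scale_le[of "Suc n" "B *v of_int_vec q"] zero by simp
      also have "0 < ?N (int (Suc n) *s q) powr (- w)"
      proof -
        have "int (Suc n) *s q \<noteq> 0"
          using that by (auto simp: vec_eq_iff simp del: of_nat_Suc)
        then show ?thesis
          using N_pos by (metis less_irrefl powr_gt_zero)
      qed
      finally show "?D (int (Suc n) *s q) < ?N (int (Suc n) *s q) powr (- w)" .
    qed
    then show False
      using fin infinite_multiples[OF that] finite_subset by blast
  qed
  define E where "E = {q. ?D q < ?N q powr (- w)} - {0}"
  define c where "c = Min (insert 1 ((\<lambda>q. ?D q * ?N q powr w) ` E))"
  have fin_E: "finite E"
    using fin by (simp add: E_def)
  have "c > 0"
    unfolding c_def using fin_E D_pos N_pos by (auto simp: E_def less_imp_neq[THEN not_sym])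
  moreover have "c * ?N q powr (- w) \<le> ?D q" if "q \<noteq> 0" for q
  proof (cases "q \<in> E")
    case True
    then have "c \<le> ?D q * ?N q powr w"
      unfolding c_def using fin_E by (intro Min_le) auto
    then show ?thesis
      using N_pos[OF that] by (simp add: powr_minus field_simps)
  next
    case False
    have "c \<le> 1"
      unfolding c_def using fin_E by (intro Min_le) auto
    then have "c * ?N q powr (- w) \<le> ?N q powr (- w)"
      by (intro mult_left_le_one_le) (use \<open>c > 0\<close> in auto)
    also have "\<dots> \<le> ?D q"
      using False that by (auto simp: E_def)
    finally show ?thesis .
  qed
  ultimately show thesis
    using that by blast
qed

section \<open>Packing in a cube\<close>

text \<open>
  Cut the cube into cells of side \<open>r\<close>, half-open so that they are disjoint. Two points in one
  cell are at sup-norm distance less than \<open>r\<close>, so each cell contains at most one of the points,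
  and each axis meets at most \<open>2 \<delta> / r + 1\<close> cells.
\<close>

lemma card_separated_le:
  fixes f :: "'a \<Rightarrow> real ^ 'm"
  assumes r: "r > 0" and \<delta>: "\<delta> > 0"
    and bound: "\<And>s. s \<in> S \<Longrightarrow> infnorm (f s) < \<delta>"
    and sep: "\<And>s t. s \<in> S \<Longrightarrow> t \<in> S \<Longrightarrow> s \<noteq> t \<Longrightarrow> r \<le> infnorm (f s - f t)"
  shows "real (card S) \<le> (2 * \<delta> / r + 1) ^ CARD('m)"
proof -
  define cell where "cell s = (\<lambda>i. \<lfloor>(f s $ i + \<delta>) / r\<rfloor>)" for s
  let ?I = "{0..\<lfloor>2 * \<delta> / r\<rfloor>}"
  have "inj_on cell S"
  proof (rule inj_onI, rule ccontr)
    fix s t assume st: "s \<in> S" "t \<in> S" "cell s = cell t" "s \<noteq> t"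
    have "\<bar>(f s - f t) $ i\<bar> < r" for i
    proof -
      have "\<lfloor>(f s $ i + \<delta>) / r\<rfloor> = \<lfloor>(f t $ i + \<delta>) / r\<rfloor>"
        using st(3) by (metis cell_def)
      then have "\<bar>(f s $ i + \<delta>) / r - (f t $ i + \<delta>) / r\<bar> < 1"
        by linarith
      also have "(f s $ i + \<delta>) / r - (f t $ i + \<delta>) / r = (f s - f t) $ i / r"
        by (simp add: diff_divide_distrib add_divide_distrib)
      finally show ?thesis
        using r by simp
    qed
    then show False
      using sep[OF st(1,2,4)] by (simp add: infnorm_less_iff_cart flip: not_less)
  qed
  moreover have "cell ` S \<subseteq> PiE UNIV (\<lambda>_. ?I)"
  proof (intro image_subsetI PiE_I)
    fix s i assume "s \<in> S"
    then have b: "\<bar>f s $ i\<bar> < \<delta>"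
      using bound infnorm_less_iff_cart by blast
    then have "(f s $ i + \<delta>) / r \<le> 2 * \<delta> / r"
      using r by (intro divide_right_mono) auto
    then show "cell s i \<in> ?I"
      unfolding cell_def using b r by (auto intro!: floor_mono divide_nonneg_pos)
  qed simp
  moreover have "finite (PiE UNIV (\<lambda>_ :: 'm. ?I))"
    by (intro finite_PiE) auto
  ultimately have "card S \<le> card (PiE UNIV (\<lambda>_ :: 'm. ?I))"
    by (rule card_inj_on_le)
  also have "\<dots> = card ?I ^ CARD('m)"
    by (simp add: card_PiE)
  finally have "real (card S) \<le> real (card ?I) ^ CARD('m)"
    by (metis of_nat_le_iff of_nat_power)
  also have "\<dots> \<le> (2 * \<delta> / r + 1) ^ CARD('m)"
  proof (rule power_mono)
    have "0 \<le> \<lfloor>2 * \<delta> / r\<rfloor>"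
      using r \<delta> by simp
    then show "real (card ?I) \<le> 2 * \<delta> / r + 1"
      by simp
  qed simp
  finally show ?thesis .
qed

section \<open>Bounding the counting function\<close>

lemma vec_cons_eq_0_iff: "vec_cons x v = 0 \<longleftrightarrow> x = 0 \<and> v = 0"
  by (force simp: vec_cons_def vec_eq_iff split: option.splits)

lemma vec_cons_diff: "vec_cons x v - vec_cons y w = vec_cons (x - y) (v - w)"
  by (simp add: vec_cons_def vec_eq_iff split: option.splits)

lemma of_int_vec_cons: "of_int_vec (vec_cons q a) = vec_cons (of_int q) (of_int_vec a)"
  by (simp add: vec_cons_def of_int_vec_def vec_eq_iff split: option.splits)

text \<open>
  Representing each counted point by its displacement from a nearby lattice point puts it in the
  cube of side \<open>2 \<delta>\<close>. Differences of representatives agree with \<open>v A\<close> up to a lattice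
  vector, so the hypothesis separates them.
\<close>

lemma counting_function_le:
  fixes A :: "real ^ 'm ^ ('d::finite option)"
  assumes r: "r > 0" and \<delta>: "\<delta> > 0"
    and sep: "\<And>v. v \<noteq> 0 \<Longrightarrow> infnorm (of_int_vec v) \<le> 2 * real Q
      \<Longrightarrow> r \<le> dist_int_vec (transpose A *v of_int_vec v)"
  shows "real (counting_function A Q \<delta> \<theta>) \<le> (2 * \<delta> / r + 1) ^ CARD('m)"
proof -
  let ?S = "counting_set A Q \<delta> \<theta>"
  define u where
    "u s = vec_cons (of_int (fst s)) (of_int_vec (snd s) + fst \<theta>) v* A - snd \<theta>" for s
  have "\<forall>s \<in> ?S. \<exists>z. infnorm (u s - of_int_vec z) < \<delta>"
    by (auto simp: counting_set_def u_def dist_int_vec_less_iff)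
  then obtain z where z: "\<And>s. s \<in> ?S \<Longrightarrow> infnorm (u s - of_int_vec (z s)) < \<delta>"
    by metis
  show ?thesis
    unfolding counting_function_def
  proof (rule card_separated_le[OF r \<delta> z])
    fix s t assume st: "s \<in> ?S" "t \<in> ?S" "s \<noteq> t"
    define v where "v = vec_cons (fst s) (snd s) - vec_cons (fst t) (snd t)"
    have "v \<noteq> 0"
      using st(3) by (auto simp: v_def vec_cons_diff vec_cons_eq_0_iff prod_eq_iff)
    moreover have "infnorm (of_int_vec v) \<le> 2 * real Q"
    proof -
      have "infnorm (of_int_vec (vec_cons (fst s) (snd s))) < real Q"
        "infnorm (of_int_vec (vec_cons (fst t) (snd t))) < real Q"
        using st(1,2) by (auto simp: counting_set_def)
      then have "\<bar>of_int_vec v $ i\<bar> \<le> 2 * real Q" for i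
        unfolding v_def of_int_vec_diff vector_minus_component infnorm_less_iff_cart abs_less_iff
          abs_le_iff
        by (auto dest!: spec[of _ i])
      then show ?thesis
        by (simp add: infnorm_le_iff_cart)
    qed
    ultimately have "r \<le> dist_int_vec (transpose A *v of_int_vec v)"
      by (rule sep)
    also have "transpose A *v of_int_vec v = u s - u t"
    proof -
      have "of_int_vec v = vec_cons (of_int (fst s)) (of_int_vec (snd s) + fst \<theta>)
          - vec_cons (of_int (fst t)) (of_int_vec (snd t) + fst \<theta>)"
        by (simp add: v_def of_int_vec_diff of_int_vec_cons vec_cons_diff)
      then show ?thesis
        by (simp add: u_def matrix_vector_mult_diff_distrib
            flip: transpose_matrix_vector)
    qed
    also have "dist_int_vec (u s - u t) \<le> infnorm (u s - u t - of_int_vec (z s - z t))"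
      by (rule dist_int_vec_le)
    also have "u s - u t - of_int_vec (z s - z t)
        = u s - of_int_vec (z s) - (u t - of_int_vec (z t))"
      by (simp add: of_int_vec_diff)
    finally show "r \<le> infnorm (u s - of_int_vec (z s) - (u t - of_int_vec (z t)))" .
  qed
qed

theorem theorem3p3:
  fixes A :: "real ^ 'm ^ ('d::finite option)" and \<sigma> \<epsilon> :: real
  assumes "dual_exponent A = ereal \<sigma>"
    and "\<epsilon> > 0"
  shows "\<exists>C > 0. \<forall>(\<theta> :: (real ^ 'd) \<times> (real ^ 'm)) (Q :: nat) (\<delta> :: real). \<delta> > 0 \<longrightarrow>
    real (counting_function A Q \<delta> \<theta>)
      \<le> max (pi ^ (2 * CARD('m)))
            (C * \<delta> ^ CARD('m) * real Q powr (real CARD('m) * \<sigma> + \<epsilon>))"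
proof -
  define m where "m = CARD('m)"
  have m: "m > 0"
    by (simp add: m_def)
  define w where "w = \<sigma> + \<epsilon> / m"
  have mw: "real m * w = real m * \<sigma> + \<epsilon>"
    using m by (simp add: w_def field_simps)
  have "\<sigma> \<ge> 0"
    using assms(1) diophantine_exponent_nonneg[of "transpose A"] by (simp add: dual_exponent_def)
  then have w: "w > 0" "\<sigma> < w"
    using assms(2) m by (simp_all add: w_def add_nonneg_pos)
  obtain c where c: "c > 0"
    and lower: "\<And>q. q \<noteq> 0 \<Longrightarrow> c * infnorm (of_int_vec q) powr (- w)
      \<le> dist_int_vec (transpose A *v of_int_vec q)"
    using diophantine_exponent_lower_bound[of "transpose A" w] assms(1) w(2)
    by (auto simp: dual_exponent_def)
  define C where "C = (3 * 2 powr w / c) ^ m"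
  have "real (counting_function A Q \<delta> \<theta>)
      \<le> max (pi ^ (2 * m)) (C * \<delta> ^ m * real Q powr (real m * \<sigma> + \<epsilon>))"
    if \<delta>: "\<delta> > 0" for \<theta> Q \<delta>
  proof (cases "Q = 0")
    case True
    have "counting_set A Q \<delta> \<theta> = {}"
      using True by (auto simp: counting_set_def not_less infnorm_pos_le)
    then show ?thesis
      by (simp add: counting_function_def le_max_iff_disj)
  next
    case False
    define r where "r = c * (2 * real Q) powr (- w)"
    have r: "r > 0"
      using c False by (simp add: r_def)
    have "r \<le> dist_int_vec (transpose A *v of_int_vec v)"
      if "v \<noteq> 0" "infnorm (of_int_vec v) \<le> 2 * real Q" for v
    proof -
      have "(2 * real Q) powr (- w) \<le> infnorm (of_int_vec v) powr (- w)"
        using infnorm_of_int_vec_ge_1[OF that(1)] that(2) w(1)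
        by (intro powr_mono2') auto
      then have "r \<le> c * infnorm (of_int_vec v) powr (- w)"
        using c by (simp add: r_def)
      then show ?thesis
        using lower[OF that(1)] by simp
    qed
    then have count: "real (counting_function A Q \<delta> \<theta>) \<le> (2 * \<delta> / r + 1) ^ m"
      unfolding m_def by (intro counting_function_le[OF r \<delta>])
    show ?thesis
    proof (cases "\<delta> \<le> r")
      case True
      then have "(2 * \<delta> / r + 1) ^ m \<le> (pi ^ 2) ^ m"
      proof (intro power_mono)
        have "2 * \<delta> / r + 1 \<le> 3"
          using True r by (simp add: field_simps)
        also have "\<dots> \<le> 3 ^ 2"
          by simp
        also have "\<dots> \<le> pi ^ 2"
          using pi_gt3 by (intro power_mono) auto
        finally show "2 * \<delta> / r + 1 \<le> pi ^ 2" .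
        show "0 \<le> 2 * \<delta> / r + 1"
          using r \<delta> by simp
      qed
      then show ?thesis
        using count by (simp add: power_mult)
    next
      case False
      have "(2 * \<delta> / r + 1) ^ m \<le> (3 * \<delta> / r) ^ m"
        using False r \<delta> by (intro power_mono) (auto simp: field_simps)
      also have "3 * \<delta> / r = 3 * 2 powr w / c * \<delta> * real Q powr w"
        using c by (simp add: r_def powr_minus powr_mult field_simps)
      also have "\<dots> ^ m = C * \<delta> ^ m * (real Q powr w) ^ m"
        by (simp add: C_def power_mult_distrib power_divide)
      also have "(real Q powr w) ^ m = real Q powr (real m * \<sigma> + \<epsilon>)"
        using \<open>Q \<noteq> 0\<close> by (simp add: powr_power flip: mw)
      finally show ?thesis
        using count by (simp add: le_max_iff_disj)
    qed
  qed
  moreover have "C > 0"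
    using c by (simp add: C_def)
  ultimately show ?thesis
    unfolding m_def by blast
qed

end
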